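(* For a primitive word $T$ over a totally ordered alphabet, the Galois rotation of $T$ can be computed in $O(|T|)$ time and $O(1)$ additional working space.
   Context: A word is primitive if it is not of the form $U^k$ with $k\ge2$. Alternating order: for words $S,T$ with $S^\omega\neq T^\omega$ ($X^\omega$ is the infinite repetition of $X$), let $j$ be the first position with $S^\omega[j]\neq T^\omega[j]$; then $S\prec_{\mathrm{alt}}T$ if either $j$ is odd and $S^\omega[j]<T^\omega[j]$, or $j$ is even and $S^\omega[j]>T^\omega[j]$. A word is Galois if it is strictly smaller with respect to $\prec_{\mathrm{alt}}$ than all its other cyclic rotations. For a primitive word $W=UV$, the rotation $VU$ is the Galois rotation of $W$ if $VU$ is Galois. The model is the word RAM with read-only input and constant-time symbol comparisons. *)

theory Defs
  imports Main "HOL-Library.Stream"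
begin

section \<open>Galois words\<close>

definition primitive :: "'a list \<Rightarrow> bool" where
  "primitive W \<longleftrightarrow> \<not> (\<exists>U k. k \<ge> 2 \<and> W = concat (replicate k U))"

text \<open>Positions of infinite words are counted from 1, which matters for the parity
  in the alternating order; \<^const>\<open>snth\<close> counts from 0.\<close>

definition omega_at :: "'a list \<Rightarrow> nat \<Rightarrow> 'a" where
  "omega_at X j = cycle X !! (j - 1)"

definition alt_less :: "'a::linorder list \<Rightarrow> 'a list \<Rightarrow> bool" where
  "alt_less S T \<longleftrightarrow> cycle S \<noteq> cycle T \<and>
    (let j = (LEAST j. 1 \<le> j \<and> omega_at S j \<noteq> omega_at T j) in
      odd j \<and> omega_at S j < omega_at T j \<or> even j \<and> omega_at S j > omega_at T j)"

text \<open>The other rotations are taken by shift amount, so that an imprimitive word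
  is never Galois.\<close>

definition galois :: "'a::linorder list \<Rightarrow> bool" where
  "galois W \<longleftrightarrow> (\<forall>k. 0 < k \<and> k < length W \<longrightarrow> alt_less W (rotate k W))"

definition galois_rotation :: "'a::linorder list \<Rightarrow> 'a list \<Rightarrow> bool" where
  "galois_rotation W R \<longleftrightarrow> primitive W \<and> (\<exists>U V. W = U @ V \<and> R = V @ U \<and> galois R)"


section \<open>The word RAM\<close>

text \<open>
  A word RAM with words of \<open>w\<close> bits, that is, numbers below \<open>2 ^ w\<close>, and memory cells holding
  one word each, initially 0.  A cell is addressed directly, by a number fixed in the program
  (such cells play the role of registers), or indirectly, by the content of another cell.

  The input is a word over an ordered alphabet.  It is not part of the memory and no instruction
  modifies it.  A program can obtain its length and can compare the symbols at two positions,
  counted from 0; the symbols themselves are not machine words.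
\<close>

datatype addr = Direct nat | Indirect nat

datatype operand = Const nat | Mem addr

datatype binop = Add | Sub | Mul | Div | Mod | And | Or | Xor | Shl | Shr

datatype test =
    WordLess operand operand
  | WordEq operand operand
  | SymLess operand operand
  | SymEq operand operand

datatype instr =
    Move addr operand
  | Arith binop addr operand operand
  | InputLength addr
  | JumpIf test nat
  | Halt

type_synonym program = "instr list"

type_synonym memory = "nat \<Rightarrow> nat"

record config =
  pc :: nat
  mem :: memory

fun address :: "memory \<Rightarrow> addr \<Rightarrow> nat" where
  "address m (Direct a) = a"
| "address m (Indirect a) = m a"

fun operand_val :: "nat \<Rightarrow> memory \<Rightarrow> operand \<Rightarrow> nat" where
  "operand_val w m (Const k) = k mod 2 ^ w"
| "operand_val w m (Mem x) = m (address m x)"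

text \<open>The arguments \<open>x\<close> and \<open>y\<close> are words; subtraction is modulo \<open>2 ^ w\<close>, like
  all other operations.\<close>

fun binop_val :: "nat \<Rightarrow> binop \<Rightarrow> nat \<Rightarrow> nat \<Rightarrow> nat" where
  "binop_val w Add x y = (x + y) mod 2 ^ w"
| "binop_val w Sub x y = (x + 2 ^ w - y) mod 2 ^ w"
| "binop_val w Mul x y = (x * y) mod 2 ^ w"
| "binop_val w Div x y = (x div y) mod 2 ^ w"
| "binop_val w Mod x y = (x mod y) mod 2 ^ w"
| "binop_val w And x y = Bit_Operations.and x y mod 2 ^ w"
| "binop_val w Or x y = Bit_Operations.or x y mod 2 ^ w"
| "binop_val w Xor x y = Bit_Operations.xor x y mod 2 ^ w"
| "binop_val w Shl x y = push_bit y x mod 2 ^ w"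
| "binop_val w Shr x y = drop_bit y x mod 2 ^ w"

text \<open>Comparing symbols outside the input has no result.\<close>

fun test_val :: "nat \<Rightarrow> 'a::linorder list \<Rightarrow> memory \<Rightarrow> test \<Rightarrow> bool option" where
  "test_val w T m (WordLess x y) = Some (operand_val w m x < operand_val w m y)"
| "test_val w T m (WordEq x y) = Some (operand_val w m x = operand_val w m y)"
| "test_val w T m (SymLess x y) =
    (let i = operand_val w m x; j = operand_val w m y in
      if i < length T \<and> j < length T then Some (T ! i < T ! j) else None)"
| "test_val w T m (SymEq x y) =
    (let i = operand_val w m x; j = operand_val w m y in
      if i < length T \<and> j < length T then Some (T ! i = T ! j) else None)"

definition store :: "addr \<Rightarrow> nat \<Rightarrow> config \<Rightarrow> config" where
  "store x v c = c\<lparr>pc := Suc (pc c), mem := (mem c)(address (mem c) x := v)\<rparr>"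

fun exec :: "nat \<Rightarrow> 'a::linorder list \<Rightarrow> instr \<Rightarrow> config \<Rightarrow> config" where
  "exec w T (Move d x) c = store d (operand_val w (mem c) x) c"
| "exec w T (Arith f d x y) c =
    store d (binop_val w f (operand_val w (mem c) x) (operand_val w (mem c) y)) c"
| "exec w T (InputLength d) c = store d (length T mod 2 ^ w) c"
| "exec w T (JumpIf b l) c =
    (case test_val w T (mem c) b of
      None \<Rightarrow> c
    | Some True \<Rightarrow> c\<lparr>pc := l\<rparr>
    | Some False \<Rightarrow> c\<lparr>pc := Suc (pc c)\<rparr>)"
| "exec w T Halt c = c"

text \<open>Running past the end of the program and comparing symbols outside the input leave the
  configuration unchanged.  Such a computation is stuck forever without being
  halted, so it does not count as terminating.\<close>

definition step :: "nat \<Rightarrow> program \<Rightarrow> 'a::linorder list \<Rightarrow> config \<Rightarrow> config" where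
  "step w p T c = (if pc c < length p then exec w T (p ! pc c) c else c)"

definition halted :: "program \<Rightarrow> config \<Rightarrow> bool" where
  "halted p c \<longleftrightarrow> pc c < length p \<and> p ! pc c = Halt"

definition config_after :: "nat \<Rightarrow> program \<Rightarrow> 'a::linorder list \<Rightarrow> nat \<Rightarrow> config" where
  "config_after w p T t = (step w p T ^^ t) \<lparr>pc = 0, mem = (\<lambda>_. 0)\<rparr>"

text \<open>The memory cells read or written by an instruction, including those read to resolve
  an indirect address.\<close>

fun addr_cells :: "memory \<Rightarrow> addr \<Rightarrow> nat set" where
  "addr_cells m (Direct a) = {a}"
| "addr_cells m (Indirect a) = {a, m a}"

fun operand_cells :: "memory \<Rightarrow> operand \<Rightarrow> nat set" where
  "operand_cells m (Const k) = {}"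
| "operand_cells m (Mem x) = addr_cells m x"

fun test_cells :: "memory \<Rightarrow> test \<Rightarrow> nat set" where
  "test_cells m (WordLess x y) = operand_cells m x \<union> operand_cells m y"
| "test_cells m (WordEq x y) = operand_cells m x \<union> operand_cells m y"
| "test_cells m (SymLess x y) = operand_cells m x \<union> operand_cells m y"
| "test_cells m (SymEq x y) = operand_cells m x \<union> operand_cells m y"

fun instr_cells :: "memory \<Rightarrow> instr \<Rightarrow> nat set" where
  "instr_cells m (Move d x) = addr_cells m d \<union> operand_cells m x"
| "instr_cells m (Arith f d x y) = addr_cells m d \<union> operand_cells m x \<union> operand_cells m y"
| "instr_cells m (InputLength d) = addr_cells m d"
| "instr_cells m (JumpIf b l) = test_cells m b"
| "instr_cells m Halt = {0}"

definition cells_used :: "nat \<Rightarrow> program \<Rightarrow> 'a::linorder list \<Rightarrow> nat \<Rightarrow> nat set" where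
  "cells_used w p T t =
    (\<Union>s\<in>{s. s \<le> t \<and> pc (config_after w p T s) < length p}.
      instr_cells (mem (config_after w p T s)) (p ! pc (config_after w p T s)))"

text \<open>On words of \<open>w\<close> bits and input \<open>T\<close>, the program halts within \<open>t\<close> instructions, accesses
  at most \<open>s\<close> memory cells and leaves the result \<open>r\<close> in cell 0.\<close>

definition computes_within ::
    "nat \<Rightarrow> program \<Rightarrow> 'a::linorder list \<Rightarrow> nat \<Rightarrow> nat \<Rightarrow> nat \<Rightarrow> bool" where
  "computes_within w p T t s r \<longleftrightarrow>
    halted p (config_after w p T t) \<and> card (cells_used w p T t) \<le> s \<and>
    mem (config_after w p T t) 0 = r"

end

theory Submission
  imports Defs
begin

text \<open>
  Suppose that the rotations starting at positions \<open>p\<close> and \<open>q\<close> first differ at offset \<open>k\<close>, and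
  that \<open>q\<close> loses.  Removing an even number of letters does not change the parities of the remaining
  positions, so for every even \<open>l \<le> k\<close> the rotation at \<open>q + l\<close> loses to the one at \<open>p + l\<close>.  Thus a
  comparison of cost \<open>k + 1\<close> eliminates \<open>q, q + 2, q + 4, \<dots>\<close> up to offset \<open>k\<close>.

  This yields a two-pointer algorithm in the style of the one for least rotations, in which
  positions are enumerated as \<open>0, 2, 4, \<dots>\<close> followed by \<open>1, 3, 5, \<dots>\<close>: two surviving candidates are
  compared, the loser moves past the eliminated positions of its parity class, and once
  the even class is exhausted it continues at position 1.  Primitivity makes every comparison
  end within \<open>length T\<close> letters.
\<close>

subsection \<open>Comparing rotations\<close>

text \<open>Offsets count from 0, so an even \<open>k\<close> is an odd position of the alternating
  order. An arbitrary sequence \<open>s\<close> keeps reduction modulo the length out of the order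
  lemmas.\<close>

definition beats_at :: "(nat \<Rightarrow> 'a::linorder) \<Rightarrow> nat \<Rightarrow> nat \<Rightarrow> nat \<Rightarrow> bool" where
  "beats_at s p q k \<longleftrightarrow> (\<forall>i<k. s (p + i) = s (q + i)) \<and>
    (if even k then s (p + k) < s (q + k) else s (q + k) < s (p + k))"

definition beats :: "(nat \<Rightarrow> 'a::linorder) \<Rightarrow> nat \<Rightarrow> nat \<Rightarrow> bool" where
  "beats s p q \<longleftrightarrow> (\<exists>k. beats_at s p q k)"

lemma not_beats_self: "\<not> beats s p p"
  by (simp add: beats_def beats_at_def)

text \<open>The first difference between \<open>p\<close> and \<open>r\<close> is at
  \<open>min k l\<close>; if \<open>k = l\<close>, both inequalities point the same way.\<close>

lemma beats_trans:
  assumes "beats s p q" "beats s q r"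
  shows "beats s p r"
proof -
  obtain k l where "beats_at s p q k" "beats_at s q r l"
    using assms by (auto simp: beats_def)
  then have "beats_at s p r (min k l)"
    by (cases k l rule: linorder_cases) (auto simp: beats_at_def min_def split: if_splits)
  then show ?thesis
    by (auto simp: beats_def)
qed

text \<open>Since \<open>l\<close> is even, \<open>k - l\<close> has the parity of \<open>k\<close>,
  so the deciding inequality keeps its direction.\<close>

lemma beats_shift:
  assumes "beats_at s p q k" "even l" "l \<le> k"
  shows "beats s (p + l) (q + l)"
proof -
  have "s (p + l + i) = s (q + l + i)" if "i < k - l" for i
    using assms that by (simp add: beats_at_def add.assoc)
  then have "beats_at s (p + l) (q + l) (k - l)"
    using assms by (auto simp: beats_at_def add.assoc)
  then show ?thesis
    by (auto simp: beats_def)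
qed

section \<open>Rotations as shifts of the periodic extension\<close>

definition letter :: "'a list \<Rightarrow> nat \<Rightarrow> 'a" where
  "letter T k = T ! (k mod length T)"

lemma letter_mod: "letter T (p mod length T + i) = letter T (p + i)"
  by (simp add: letter_def mod_simps)

lemma beats_mod: "beats (letter T) (p mod length T) (q mod length T) = beats (letter T) p q"
  by (simp add: beats_def beats_at_def letter_mod)

lemma omega_at_rotate:
  assumes "T \<noteq> []"
  shows "omega_at (rotate p T) (Suc k) = letter T (p + k)"
proof -
  \<comment> \<open>Entry \<open>k\<close> of a stream heads its \<open>k\<close>-th tail, and a
    tail of a cycle is the cycle of a rotation.\<close>
  have "cycle (rotate p T) !! k = hd (rotate k (rotate p T))"
    using assms by (simp add: sdrop_cycle flip: sdrop_simps(1)) 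
      (metis length_rotate rotate_conv_mod rotate_rotate)
  then show ?thesis
    using assms by (simp add: omega_at_def letter_def hd_rotate_conv_nth rotate_rotate add.commute)
qed

lemma alt_less_rotate:
  assumes "T \<noteq> []" "beats (letter T) p q"
  shows "alt_less (rotate p T) (rotate q T)"
proof -
  obtain k where k: "beats_at (letter T) p q k"
    using assms by (auto simp: beats_def)
  note at = omega_at_rotate[OF \<open>T \<noteq> []\<close>]
  have neq: "omega_at (rotate p T) (Suc k) \<noteq> omega_at (rotate q T) (Suc k)"
    using k by (auto simp: at beats_at_def split: if_splits)
  have least: "(LEAST j. 1 \<le> j \<and> omega_at (rotate p T) j \<noteq> omega_at (rotate q T) j) = Suc k"
  proof (rule Least_equality)
    fix j assume j: "1 \<le> j \<and> omega_at (rotate p T) j \<noteq> omega_at (rotate q T) j"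
    then obtain i where "j = Suc i" by (cases j) auto
    with j have "letter T (p + i) \<noteq> letter T (q + i)" by (simp add: at)
    with k have "\<not> i < k" by (auto simp: beats_at_def)
    with \<open>j = Suc i\<close> show "Suc k \<le> j" by simp
  qed (use neq in simp)
  have "cycle (rotate p T) \<noteq> cycle (rotate q T)"
    using neq by (auto simp: omega_at_def)
  then show ?thesis
    using k unfolding alt_less_def least Let_def by (auto simp: at beats_at_def split: if_splits)
qed

section \<open>Rotations of primitive words\<close>

lemma primitive_nonempty: "primitive T \<Longrightarrow> T \<noteq> []"
  unfolding primitive_def by (metis concat_replicate_trivial order_refl)

text \<open>A rotation fixing \<open>T\<close> splits it into two nonempty commuting factors, so
  \<open>T\<close> is a proper power.\<close>

lemma rotate_neq_self_if_primitive:
  assumes "primitive T" "0 < d" "d < length T"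
  shows "rotate d T \<noteq> T"
proof
  assume "rotate d T = T"
  then have "drop d T @ take d T = take d T @ drop d T"
    using assms by (simp add: rotate_drop_take)
  from comm_append_is_replicate[OF _ _ this] obtain n U
    where "n > 1" "concat (replicate n U) = drop d T @ take d T"
    using assms primitive_nonempty[OF assms(1)] by auto
  then have "T = concat (replicate n U)" "n \<ge> 2"
    using \<open>rotate d T = T\<close> assms by (auto simp: rotate_drop_take)
  then show False
    using \<open>primitive T\<close> unfolding primitive_def by blast
qed

lemma primitive_letters_differ:
  assumes "primitive T" "p < length T" "q < length T" "p \<noteq> q"
  shows "\<exists>k<length T. letter T (p + k) \<noteq> letter T (q + k)"
proof -
  have *: "\<exists>k<length T. letter T (p + k) \<noteq> letter T (q + k)"
    if "p < q" "q < length T" for p q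
  proof (rule ccontr)
    assume "\<not> ?thesis"
    then have eq: "rotate p T = rotate q T"
      by (intro nth_equalityI) (auto simp: letter_def nth_rotate)
    \<comment> \<open>A full turn changes nothing, so \<open>rotate q\<close> can be split off and
      replaced by \<open>rotate p\<close>, which again leaves a full turn.\<close>
    have "rotate (q - p) T = rotate ((length T + (q - p)) mod length T) T"
      by (simp flip: rotate_conv_mod)
    also have "\<dots> = rotate (length T - p + q) T"
      using that by (simp only: flip: rotate_conv_mod) simp
    also have "\<dots> = rotate (length T - p + p) T"
      using eq by (simp only: flip: rotate_rotate)
    also have "\<dots> = T"
      using that by simp
    finally have "rotate (q - p) T = T" .
    moreover have "0 < q - p" "q - p < length T"
      using that by simp_all
    ultimately show False
      using rotate_neq_self_if_primitive[OF \<open>primitive T\<close>] by blast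
  qed
  show ?thesis
    using *[of p q] *[of q p] assms by (metis linorder_neqE_nat)
qed

lemma beats_total:
  assumes "primitive T" "p < length T" "q < length T" "p \<noteq> q"
  shows "beats (letter T) p q \<or> beats (letter T) q p"
proof -
  define k where "k = (LEAST k. letter T (p + k) \<noteq> letter T (q + k))"
  have "letter T (p + k) \<noteq> letter T (q + k)"
    using primitive_letters_differ[OF assms] unfolding k_def by (metis (mono_tags, lifting) LeastI)
  moreover have "letter T (p + i) = letter T (q + i)" if "i < k" for i
    using not_less_Least that unfolding k_def by blast
  ultimately have "beats_at (letter T) p q k \<or> beats_at (letter T) q p k"
    by (auto simp: beats_at_def)
  then show ?thesis
    by (auto simp: beats_def)
qed

text \<open>It is enough that every other position loses to something: a finite strict order has an
  unbeaten element, which can only be \<open>a\<close>, and totality makes \<open>a\<close> beat the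
  rest.\<close>

lemma galois_rotation_unbeaten:
  assumes "primitive T" "a < length T"
    and beaten: "\<And>t. \<lbrakk>t < length T; t \<noteq> a\<rbrakk> \<Longrightarrow> \<exists>u. beats (letter T) u t"
  shows "galois_rotation T (drop a T @ take a T)"
proof -
  let ?n = "length T"
  have "T \<noteq> []" using \<open>a < ?n\<close> by auto
  obtain m where m: "m < ?n" "\<And>t. t < ?n \<Longrightarrow> \<not> beats (letter T) t m"
  proof -
    have "asymp_on {..<?n} (beats (letter T))"
      by (rule asymp_onI) (meson beats_trans not_beats_self)
    moreover have "transp_on {..<?n} (beats (letter T))"
      by (rule transp_onI) (rule beats_trans)
    ultimately obtain m
      where "m < ?n" "\<forall>t\<in>{..<?n}. t \<noteq> m \<longrightarrow> \<not> beats (letter T) t m"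
      using Finite_Set.bex_min_element[of "{..<?n}" "beats (letter T)"] \<open>a < ?n\<close> by auto
    then show ?thesis
      using that[of m] not_beats_self[of "letter T" m] by (metis lessThan_iff)
  qed
  have "m = a"
  proof (rule ccontr)
    assume "m \<noteq> a"
    \<comment> \<open>The winner \<open>u\<close> may lie beyond the end of the word, so it is
      reduced modulo the length.\<close>
    then obtain u where "beats (letter T) (u mod ?n) (m mod ?n)"
      unfolding beats_mod using beaten m(1) by blast
    moreover have "u mod ?n < ?n" using \<open>T \<noteq> []\<close> by simp
    ultimately show False using m by simp
  qed
  have win: "beats (letter T) a t" if "t < ?n" "t \<noteq> a" for t
    using beats_total[OF \<open>primitive T\<close> assms(2) that(1)] m that \<open>m = a\<close> by auto
  have rot: "drop a T @ take a T = rotate a T"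
    using assms by (simp add: rotate_drop_take)
  have "galois (rotate a T)"
    unfolding galois_def
  proof safe
    fix k assume k: "0 < k" "k < length (rotate a T)"
    have "(k + a) mod ?n \<noteq> a" 
    proof
      assume "(k + a) mod ?n = a"
      then have "(k + a) mod ?n = a mod ?n" using assms by simp
      then have "?n dvd k" by (simp add: mod_eq_dvd_iff_nat)
      then show False using k by (auto dest: dvd_imp_le)
    qed
    then have "beats (letter T) a ((k + a) mod ?n)"
      using win \<open>T \<noteq> []\<close> by simp
    then have "beats (letter T) a (k + a)"
      using beats_mod[of T a "(k + a) mod ?n"] beats_mod[of T a "k + a"] by simp
    then show "alt_less (rotate a T) (rotate k (rotate a T))"
      using alt_less_rotate \<open>T \<noteq> []\<close> by (simp add: rotate_rotate)
  qed
  then show ?thesis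
    using assms unfolding galois_rotation_def rot[symmetric]
    by (metis append_take_drop_id)
qed

subsection \<open>Single-loop programs\<close>

text \<open>
  A program that consists of a single loop is given by a decision tree for the loop body; \<open>Again\<close> returns to the
  head \<open>l\<close> of the loop.
\<close>

datatype code = Done | Again | Do instr code | Branch test code code

fun assignment :: "instr \<Rightarrow> bool" where
  "assignment (JumpIf b l) = False"
| "assignment Halt = False"
| "assignment _ = True"

primrec well_formed :: "code \<Rightarrow> bool" where
  "well_formed Done = True"
| "well_formed Again = True"
| "well_formed (Do i c) = (assignment i \<and> well_formed c)"
| "well_formed (Branch b c d) = (well_formed c \<and> well_formed d)"

text \<open>\<open>Done\<close> costs nothing, since the machine has halted on reaching
  \<open>Halt\<close>; \<open>Again\<close> costs the jump back.\<close>

primrec depth :: "code \<Rightarrow> nat" where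
  "depth Done = 0"
| "depth Again = 1"
| "depth (Do i c) = Suc (depth c)"
| "depth (Branch b c d) = Suc (max (depth c) (depth d))"

primrec code_size :: "code \<Rightarrow> nat" where
  "code_size Done = 1"
| "code_size Again = 1"
| "code_size (Do i c) = Suc (code_size c)"
| "code_size (Branch b c d) = Suc (code_size c + code_size d)"

text \<open>\<open>pos\<close> is the absolute address of the first instruction. The branch for a
  failed test follows the test directly. An always true test serves as unconditional jump.\<close>

primrec compile :: "nat \<Rightarrow> nat \<Rightarrow> code \<Rightarrow> program" where
  "compile l pos Done = [Halt]"
| "compile l pos Again = [JumpIf (WordEq (Const 0) (Const 0)) l]"
| "compile l pos (Do i c) = i # compile l (Suc pos) c"
| "compile l pos (Branch b c d) =
    JumpIf b (Suc (pos + code_size d)) # compile l (Suc pos) d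
      @ compile l (Suc (pos + code_size d)) c"

lemma length_compile [simp]: "length (compile l pos c) = code_size c"
  by (induction c arbitrary: pos) auto

text \<open>The flag tells \<open>Done\<close> from \<open>Again\<close>; \<open>None\<close> stands
  for a machine stuck on symbols outside the input.\<close>

primrec eval :: "nat \<Rightarrow> 'a::linorder list \<Rightarrow> code \<Rightarrow> memory \<Rightarrow> (memory \<times> bool) option" where
  "eval w T Done m = Some (m, True)"
| "eval w T Again m = Some (m, False)"
| "eval w T (Do i c) m = eval w T c (mem (exec w T i \<lparr>pc = 0, mem = m\<rparr>))"
| "eval w T (Branch b c d) m = (case test_val w T m b of
      None \<Rightarrow> None
    | Some v \<Rightarrow> if v then eval w T c m else eval w T d m)"

lemma exec_assignment:
  "assignment i \<Longrightarrow>
    exec w T i \<lparr>pc = a, mem = m\<rparr> = \<lparr>pc = Suc a, mem = mem (exec w T i \<lparr>pc = 0, mem = m\<rparr>)\<rparr>"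
  by (cases i) (auto simp: store_def)

text \<open>Arbitrary surrounding code \<open>pre\<close> and \<open>post\<close> lets the induction
  descend into subtrees at their own addresses, while the loop head \<open>l\<close> stays
  fixed.\<close>

lemma eval_steps:
  assumes "well_formed c" "eval w T c m = Some (m', fin)"
    and "p = pre @ compile l (length pre) c @ post"
  shows "\<exists>t\<le>depth c. \<exists>a. (step w p T ^^ t) \<lparr>pc = length pre, mem = m\<rparr> = \<lparr>pc = a, mem = m'\<rparr> \<and>
    (if fin then halted p \<lparr>pc = a, mem = m'\<rparr> else a = l)"
  using assms
proof (induction c arbitrary: m pre post)
  case Done
  then show ?case
    by (auto simp: halted_def intro!: exI[of _ 0])
next
  case Again
  then show ?case
    by (auto simp: step_def intro!: exI[of _ 1])
next
  case (Do i c)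
  let ?m = "mem (exec w T i \<lparr>pc = 0, mem = m\<rparr>)"
  have 1: "step w p T \<lparr>pc = length pre, mem = m\<rparr> = \<lparr>pc = Suc (length pre), mem = ?m\<rparr>"
    using Do.prems exec_assignment[of i] by (simp add: step_def)
  have "\<exists>t\<le>depth c. \<exists>a. (step w p T ^^ t) \<lparr>pc = length (pre @ [i]), mem = ?m\<rparr> = \<lparr>pc = a, mem = m'\<rparr> \<and>
    (if fin then halted p \<lparr>pc = a, mem = m'\<rparr> else a = l)"
    using Do.prems by (intro Do.IH[where post = post]) auto
  then obtain t a where "t \<le> depth c"
    "(step w p T ^^ t) \<lparr>pc = Suc (length pre), mem = ?m\<rparr> = \<lparr>pc = a, mem = m'\<rparr>"
    "if fin then halted p \<lparr>pc = a, mem = m'\<rparr> else a = l"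
    by auto
  with 1 show ?case
    by (intro exI[of _ "Suc t"]) (auto simp del: funpow.simps simp: funpow_Suc_right)
next
  case (Branch b c d)
  obtain v where v: "test_val w T m b = Some v"
    and ev: "eval w T (if v then c else d) m = Some (m', fin)"
    using Branch.prems by (auto split: option.splits if_splits)
  let ?e = "if v then c else d"
  let ?pre = "if v then pre @ JumpIf b (Suc (length pre + code_size d)) # compile l (Suc (length pre)) d
    else pre @ [JumpIf b (Suc (length pre + code_size d))]"
  have 1: "step w p T \<lparr>pc = length pre, mem = m\<rparr> = \<lparr>pc = length ?pre, mem = m\<rparr>"
    using Branch.prems v by (simp add: step_def)
  have "\<exists>t\<le>depth ?e. \<exists>a. (step w p T ^^ t) \<lparr>pc = length ?pre, mem = m\<rparr> = \<lparr>pc = a, mem = m'\<rparr> \<and>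
    (if fin then halted p \<lparr>pc = a, mem = m'\<rparr> else a = l)"
  proof (cases v)
    case True
    then show ?thesis
      using Branch.prems ev Branch.IH(1)[of m ?pre post] by simp
  next
    case False
    then show ?thesis
      using Branch.prems ev
        Branch.IH(2)[of m ?pre "compile l (Suc (length pre + code_size d)) c @ post"] by simp
  qed
  then obtain t a where "t \<le> depth ?e"
    "(step w p T ^^ t) \<lparr>pc = length ?pre, mem = m\<rparr> = \<lparr>pc = a, mem = m'\<rparr>"
    "if fin then halted p \<lparr>pc = a, mem = m'\<rparr> else a = l"
    by blast
  moreover have "depth ?e < depth (Branch b c d)"
    by auto
  ultimately show ?case
    using 1 by (intro exI[of _ "Suc t"]) (auto simp del: funpow.simps simp: funpow_Suc_right)
qed

text \<open>The potential \<open>f\<close> grows with every pass and stays below \<open>B\<close>,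
  so there are at most \<open>B - f\<close> passes of at most \<open>depth c\<close> steps
  each.\<close>

lemma loop_steps:
  assumes "well_formed c" and p: "p = pre @ compile (length pre) (length pre) c"
    and bound: "\<And>f m. I f m \<Longrightarrow> f < (B :: nat)"
    and body: "\<And>f m. I f m \<Longrightarrow>
      (\<exists>m'. eval w T c m = Some (m', True) \<and> Q m') \<or>
      (\<exists>m' f'. eval w T c m = Some (m', False) \<and> f < f' \<and> I f' m')"
    and "I f m"
  shows "\<exists>t\<le>(B - f) * depth c. \<exists>r. (step w p T ^^ t) \<lparr>pc = length pre, mem = m\<rparr> = r \<and>
    halted p r \<and> Q (mem r)"
  using \<open>I f m\<close>
proof (induction "B - f" arbitrary: f m rule: less_induct)
  case less
  note steps = eval_steps[OF \<open>well_formed c\<close> _, of w T m _ _ p pre "length pre" "[]"]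
  have less_B: "f < B" using bound less.prems .
  from body[OF less.prems] show ?case
  proof (elim disjE exE conjE)
    fix m' assume "eval w T c m = Some (m', True)" "Q m'"
    with steps p obtain t a where "t \<le> depth c"
      "(step w p T ^^ t) \<lparr>pc = length pre, mem = m\<rparr> = \<lparr>pc = a, mem = m'\<rparr>"
      "halted p \<lparr>pc = a, mem = m'\<rparr>"
      by fastforce
    moreover have "depth c \<le> (B - f) * depth c"
      using less_B by (cases "B - f") simp_all
    ultimately show ?thesis
      using \<open>Q m'\<close> by (intro exI[of _ t]) (auto intro: order.trans)
  next
    fix m' f' assume m': "eval w T c m = Some (m', False)" "f < f'" "I f' m'"
    with steps p obtain t where t: "t \<le> depth c"
      "(step w p T ^^ t) \<lparr>pc = length pre, mem = m\<rparr> = \<lparr>pc = length pre, mem = m'\<rparr>"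
      by fastforce
    have "f' < B" using bound m' by blast
    then obtain u r where u: "u \<le> (B - f') * depth c"
      "(step w p T ^^ u) \<lparr>pc = length pre, mem = m'\<rparr> = r" "halted p r" "Q (mem r)"
      using less.hyps[of f' m'] m' by (metis diff_less_mono2 less_trans)
    have "(step w p T ^^ (u + t)) \<lparr>pc = length pre, mem = m\<rparr> = r"
      using t u by (simp add: funpow_add)
    moreover have "u + t \<le> (B - f) * depth c"
    proof -
      have "u + t \<le> Suc (B - f') * depth c" using t u by simp
      also have "\<dots> \<le> (B - f) * depth c"
        using m'(2) \<open>f' < B\<close> by (intro mult_le_mono1) simp
      finally show ?thesis .
    qed
    ultimately show ?thesis
      using u by blast
  qed
qed

lemma steps_after_halt:
  assumes "halted p c"
  shows "(step w p T ^^ t) c = c"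
  by (induction t) (use assms in \<open>auto simp: step_def halted_def\<close>)

text \<open>Suited to programs without indirect addresses, whose cells can be read off the program
  text.\<close>

lemma card_cells_used:
  assumes "\<And>i m. i \<in> set p \<Longrightarrow> instr_cells m i \<subseteq> {..<s}"
  shows "card (cells_used w p T t) \<le> s"
proof -
  have "cells_used w p T t \<subseteq> {..<s}"
    unfolding cells_used_def using assms nth_mem by (intro UN_least) blast
  then show ?thesis
    using card_mono[of "{..<s}"] by fastforce
qed

subsection \<open>The two-pointer program\<close>

text \<open>Cell 0 is the output cell, so the surviving candidate is already in place at the
  end.\<close>

abbreviation (input) "best \<equiv> 0 :: nat"
abbreviation (input) "rival \<equiv> 1 :: nat"
abbreviation (input) "best_pos \<equiv> 2 :: nat"
abbreviation (input) "rival_pos \<equiv> 3 :: nat"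
abbreviation (input) "parity \<equiv> 4 :: nat"
abbreviation (input) "len \<equiv> 5 :: nat"
abbreviation (input) "tmp \<equiv> 6 :: nat"

abbreviation reg :: "nat \<Rightarrow> operand" where
  "reg r \<equiv> Mem (Direct r)"

abbreviation assign :: "nat \<Rightarrow> operand \<Rightarrow> code \<Rightarrow> code" where
  "assign r x c \<equiv> Do (Move (Direct r) x) c"

abbreviation compute :: "nat \<Rightarrow> binop \<Rightarrow> operand \<Rightarrow> operand \<Rightarrow> code \<Rightarrow> code" where
  "compute r f x y c \<equiv> Do (Arith f (Direct r) x y) c"

text \<open>
  \<open>rival_pos\<close> doubles as the position the loser moves to.  The offset of the current comparison is not
  stored: it is less than the input length, so \<open>rival_pos < rival\<close> tells that the comparison
  has run past the end of the input.
\<close>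

definition bump :: "code \<Rightarrow> code \<Rightarrow> code" where
  "bump over c = compute rival_pos Add (reg rival_pos) (Const 1)
    (Branch (WordEq (reg rival_pos) (reg len)) over c)"

definition restart :: code where
  "restart = assign rival (reg rival_pos) (assign best_pos (reg best) (assign parity (Const 0) Again))"

text \<open>The candidates must differ, so a new position equal to \<open>best\<close> is passed
  over by two, which keeps its class.\<close>

definition settle :: "code \<Rightarrow> code" where
  "settle over = Branch (WordEq (reg rival_pos) (reg best)) (bump over (bump over restart)) restart"

text \<open>\<open>rival\<close> still holds the old position of the loser, whose parity tells the
  class. After the odd class nothing remains.\<close>

definition next_class :: code where
  "next_class = compute tmp And (reg rival) (Const 1)
    (Branch (WordEq (reg tmp) (Const 0)) (assign rival_pos (Const 1) (settle Done)) Done)"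

text \<open>The next position of the loser's class lies one or two past the last letter compared,
  according as the offset is odd or even.\<close>

definition advance :: code where
  "advance = Branch (WordLess (reg rival_pos) (reg rival)) next_class
    (bump next_class
      (Branch (WordEq (reg parity) (Const 0))
        (bump next_class (settle next_class))
        (settle next_class)))"

definition swap_advance :: code where
  "swap_advance = assign tmp (reg best) (assign best (reg rival) (assign rival (reg tmp)
    (assign rival_pos (reg best_pos) advance)))"

definition step_pos :: "nat \<Rightarrow> code \<Rightarrow> code" where
  "step_pos r c = compute r Add (reg r) (Const 1) (compute r Mod (reg r) (reg len) c)"

definition body :: code where
  "body = Branch (SymEq (reg best_pos) (reg rival_pos))
    (step_pos best_pos (step_pos rival_pos (compute parity Sub (Const 1) (reg parity) Again)))
    (Branch (SymLess (reg best_pos) (reg rival_pos))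
      (Branch (WordEq (reg parity) (Const 0)) advance swap_advance)
      (Branch (WordEq (reg parity) (Const 0)) swap_advance advance))"

text \<open>For length 1 the initial memory already holds the answer 0. Otherwise 0 meets 2, or 1 if
  there is no position 2.\<close>

definition start :: code where
  "start = Do (InputLength (Direct len)) (Branch (WordEq (reg len) (Const 1)) Done
    (assign rival_pos (Const 1) (bump (assign rival_pos (Const 1) restart) restart)))"

definition galois_program :: program where
  "galois_program = compile (code_size start) 0 start
    @ compile (code_size start) (code_size start) body"

lemmas code_defs = start_def body_def step_pos_def swap_advance_def advance_def next_class_def
  settle_def restart_def bump_def

lemma well_formed_body: "well_formed body" and well_formed_start: "well_formed start"
  by (simp_all add: code_defs)

lemma instr_cells_galois_program:
  "i \<in> set galois_program \<Longrightarrow> instr_cells m i \<subseteq> {..<7}"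
  by (auto simp: galois_program_def code_defs)

text \<open>
  With \<open>2 * n\<close> for the passage from the even to the odd class,
  the potential \<open>rank n a + rank n b + k\<close> increases in every iteration: leaving the even class costs
  at most \<open>n\<close> comparisons and may not advance the position.
\<close>

definition rank :: "nat \<Rightarrow> nat \<Rightarrow> nat" where
  "rank n t = t + (if odd t then 2 * n else 0)"

definition ready :: "nat \<Rightarrow> nat \<Rightarrow> nat \<Rightarrow> memory \<Rightarrow> bool" where
  "ready n a b m \<longleftrightarrow> m best = a \<and> m rival = b \<and> m best_pos = a \<and> m rival_pos = b \<and>
    m parity = 0 \<and> m len = n"

text \<open>
  Outcome of a round lost by \<open>b\<close> against \<open>a\<close> at offset \<open>k\<close>, where \<open>L\<close> contains the positions known to be
  beaten.
\<close>

definition moves :: "nat \<Rightarrow> nat \<Rightarrow> nat \<Rightarrow> nat \<Rightarrow> nat set \<Rightarrow> (memory \<times> bool) option \<Rightarrow> bool" where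
  "moves n a b k L r \<longleftrightarrow>
    (\<exists>m. r = Some (m, True) \<and> m best = a \<and> (\<forall>t<n. rank n b \<le> rank n t \<longrightarrow> t = a \<or> t \<in> L)) \<or>
    (\<exists>m b'. r = Some (m, False) \<and> b' < n \<and> b' \<noteq> a \<and> rank n b + k < rank n b' \<and> ready n a b' m \<and>
      (\<forall>t<n. rank n b \<le> rank n t \<longrightarrow> rank n t < rank n b' \<longrightarrow> t = a \<or> t \<in> L))"

text \<open>Either candidate may be further along in the enumeration, hence \<open>max\<close>.
  \<open>f\<close> is the potential that bounds the number of iterations.\<close>

definition loop_inv :: "nat \<Rightarrow> 'a::linorder list \<Rightarrow> nat \<Rightarrow> memory \<Rightarrow> bool" where
  "loop_inv n T f m \<longleftrightarrow> (\<exists>a b k. a < n \<and> b < n \<and> a \<noteq> b \<and> m best = a \<and> m rival = b \<and>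
    m best_pos = (a + k) mod n \<and> m rival_pos = (b + k) mod n \<and> m parity = k mod 2 \<and> m len = n \<and>
    (\<forall>i<k. letter T (a + i) = letter T (b + i)) \<and>
    (\<forall>t<n. rank n t < max (rank n a) (rank n b) \<longrightarrow> t \<noteq> a \<longrightarrow> t \<noteq> b \<longrightarrow> (\<exists>u. beats (letter T) u t)) \<and>
    f = rank n a + rank n b + k)"

definition loop_result :: "nat \<Rightarrow> 'a::linorder list \<Rightarrow> memory \<Rightarrow> bool" where
  "loop_result n T m \<longleftrightarrow> m best < n \<and> (\<forall>t<n. t \<noteq> m best \<longrightarrow> (\<exists>u. beats (letter T) u t))"

section \<open>One round between two candidates\<close>

context
  fixes w n :: nat and T :: "'a::linorder list"
  assumes n: "n = length T" "2 \<le> n" "n < 2 ^ w"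
begin

lemma Suc_mod_word: "x < n \<Longrightarrow> Suc x mod 2 ^ w = Suc x"
  using n by simp

lemma word_size_pos: "0 < w"
  using n by (cases w) auto

lemma eval_bump:
  "\<lbrakk>m rival_pos < n; m len = n\<rbrakk> \<Longrightarrow>
    eval w T (bump over c) m =
      eval w T (if Suc (m rival_pos) = n then over else c) (m(rival_pos := Suc (m rival_pos)))"
  by (simp add: bump_def store_def Suc_mod_word word_size_pos)

lemma eval_restart:
  "eval w T restart m = Some (m(rival := m rival_pos, best_pos := m best, parity := 0), False)"
  by (simp add: restart_def store_def)

lemma moves_restart:
  assumes "m best = a" "m rival_pos = y" "m len = n" "y < n" "y \<noteq> a" "rank n b + k < rank n y"
    and "\<And>t. \<lbrakk>t < n; rank n b \<le> rank n t; rank n t < rank n y\<rbrakk> \<Longrightarrow> t = a \<or> t \<in> L"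
  shows "moves n a b k L (eval w T restart m)"
  using assms by (auto simp: moves_def eval_restart ready_def)

text \<open>\<open>over\<close> is reached only if \<open>best\<close> occupies \<open>y\<close> and
  its class has no later position; \<open>z\<close> is whatever \<open>rival_pos\<close> then
  contains.\<close>

lemma moves_settle:
  assumes m: "m best = a" "m rival_pos = y" "m len = n" and "y < n" "rank n b + k < rank n y"
    and lost: "\<And>t. \<lbrakk>t < n; rank n b \<le> rank n t; rank n t < rank n y\<rbrakk> \<Longrightarrow> t = a \<or> t \<in> L"
    and over: "\<And>z. \<lbrakk>y = a; n \<le> y + 2\<rbrakk> \<Longrightarrow> moves n a b k L (eval w T over (m(rival_pos := z)))"
  shows "moves n a b k L (eval w T (settle over) m)"
proof (cases "y = a")
  case False
  then show ?thesis
    using m by (simp add: settle_def) (intro moves_restart[where y = y]; use assms in simp)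
next
  case True
  show ?thesis
  proof (cases "y + 2 < n")
    case False
    then show ?thesis
      using True over assms by (simp add: settle_def eval_bump)
  next
    case less: True
    have "moves n a b k L (eval w T restart (m(rival_pos := y + 2)))"
    proof (rule moves_restart[where y = "y + 2"])
      fix t assume t: "t < n" "rank n b \<le> rank n t" "rank n t < rank n (y + 2)"
      then show "t = a \<or> t \<in> L"
      proof (cases "rank n t < rank n y")
        case False
        \<comment> \<open>No rank lies strictly between those of \<open>y\<close> and
          \<open>y + 2\<close>.\<close>
        then have "t = y"
          using t \<open>y < n\<close> by (auto simp: rank_def split: if_splits) presburger+
        then show ?thesis using True by simp
      qed (use lost in auto)
    qed (use m True less assms in \<open>auto simp: rank_def\<close>)
    then show ?thesis
      using True less m by (simp add: settle_def eval_bump)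
  qed
qed

lemma moves_next_class:
  assumes m: "m best = a" "m rival = b" "m len = n" and "b < n" "k < n"
    and lost: "\<And>t. \<lbrakk>t < n; b \<le> t; even t = even b\<rbrakk> \<Longrightarrow> t = a \<or> t \<in> L"
  shows "moves n a b k L (eval w T next_class m)"
proof (cases "even b")
  case False
  \<comment> \<open>Odd positions come last in rank, so no other class remains.\<close>
  have "t = a \<or> t \<in> L" if "t < n" "rank n b \<le> rank n t" for t
    using lost[of t] that False by (auto simp: rank_def split: if_splits)
  then show ?thesis
    using False m word_size_pos
    by (auto simp: next_class_def store_def moves_def and_one_eq odd_iff_mod_2_eq_one)
next
  case True
  \<comment> \<open>Position 1 is the first odd one, and moving there is progress because
    \<open>b + k < 2 * n < rank n 1\<close>.\<close>
  have "moves n a b k L (eval w T (settle Done) (m(tmp := 0, rival_pos := 1)))"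
  proof (rule moves_settle[where y = 1])
    show lost1: "t = a \<or> t \<in> L" if "t < n" "rank n b \<le> rank n t" "rank n t < rank n 1" for t
      using lost[of t] that True by (auto simp: rank_def split: if_splits)
    \<comment> \<open>Here 1 is the only odd position.\<close>
    fix z assume "1 = a" "n \<le> 1 + 2"
    then have "t = a \<or> t \<in> L" if "t < n" "rank n b \<le> rank n t" for t
    proof (cases "rank n t < rank n 1")
      case False
      then have "odd t" using that \<open>2 \<le> n\<close> by (auto simp: rank_def split: if_splits)
      then have "t = 1" using that \<open>n \<le> 1 + 2\<close> by presburger
      then show ?thesis using \<open>1 = a\<close> by simp
    qed (use that lost1 in auto)
    then show "moves n a b k L (eval w T Done (m(tmp := 0, rival_pos := 1, rival_pos := z)))"
      using m by (auto simp: moves_def)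
  qed (use assms n True in \<open>auto simp: rank_def\<close>)
  then show ?thesis
    using True m word_size_pos by (simp add: next_class_def store_def and_one_eq even_iff_mod_2_eq_zero)
qed

lemma moves_advance:
  assumes m: "m best = a" "m rival = b" "m rival_pos = (b + k) mod n" "m parity = k mod 2" "m len = n"
    and "b < n" "k < n"
    and lost: "\<And>l. \<lbrakk>even l; l \<le> k\<rbrakk> \<Longrightarrow> (b + l) mod n \<in> L"
  shows "moves n a b k L (eval w T advance m)"
proof -
  have lost': "t \<in> L" if "t < n" "b \<le> t" "even t = even b" "t \<le> b + k" for t
    using lost[of "t - b"] that by simp
  \<comment> \<open>The bound on \<open>n\<close> says that the next position after
    \<open>b + k\<close> in the class of \<open>b\<close> is outside the input.\<close>
  have wrap: "moves n a b k L (eval w T next_class m')"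
    if "m' best = a" "m' rival = b" "m' len = n" "n \<le> b + k + 1 + (if even k then 1 else 0)" for m'
  proof (rule moves_next_class)
    fix t assume t: "t < n" "b \<le> t" "even t = even b"
    then have "t \<le> b + k" 
      using that(4) by (auto split: if_splits) presburger+
    then show "t = a \<or> t \<in> L" using lost' t by blast
  qed (use that assms in auto)
  show ?thesis
  proof (cases "b + k < n")
    case False
    \<comment> \<open>As \<open>k < n\<close>, the comparison wraps once and ends strictly before
      \<open>b\<close>, which is what \<open>advance\<close> tests first.\<close>
    then have "(b + k) mod n = b + k - n" "b + k - n < b"
      using assms by (auto simp: mod_if)
    then show ?thesis
      using False assms wrap[of m] by (simp add: advance_def)
  next
    case True
    \<comment> \<open>The first position past \<open>b + k\<close> with the parity of
      \<open>b\<close>.\<close>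
    define y where "y = b + k + 1 + (if even k then 1 else 0)"
    have parity: "even y = even b" by (auto simp: y_def)
    have settled: "moves n a b k L (eval w T (settle next_class) (m(rival_pos := y)))" if "y < n"
    proof (rule moves_settle[where y = y])
      show "t = a \<or> t \<in> L" if "t < n" "rank n b \<le> rank n t" "rank n t < rank n y" for t
      proof -
        have "even t = even b" "b \<le> t" "t < y"
          using that parity \<open>y < n\<close> \<open>b < n\<close> by (auto simp: rank_def split: if_splits)
        moreover from this have "t \<le> b + k"
          using parity by (auto simp: y_def split: if_splits) presburger+
        ultimately show ?thesis using lost' that by blast
      qed
      fix z assume "y = a" "n \<le> y + 2"
      show "moves n a b k L (eval w T next_class (m(rival_pos := y, rival_pos := z)))"
      proof (rule moves_next_class)
        fix t assume t: "t < n" "b \<le> t" "even t = even b"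
        show "t = a \<or> t \<in> L"
        proof (cases "t \<le> b + k")
          case False
          then have "t = y"
            using t parity \<open>n \<le> y + 2\<close> by (auto simp: y_def split: if_splits) presburger+
          then show ?thesis using \<open>y = a\<close> by simp
        qed (use lost' t in blast)
      qed (use assms in auto)
    qed (use assms that parity in \<open>auto simp: rank_def y_def\<close>)
    show ?thesis
      using True assms settled wrap
      by (auto simp: advance_def eval_bump y_def even_iff_mod_2_eq_zero odd_iff_mod_2_eq_one split: if_splits)
  qed
qed

lemma moves_swap_advance:
  assumes "m best = a" "m rival = b" "m best_pos = (a + k) mod n" "m parity = k mod 2" "m len = n"
    and "a < n" "k < n"
    and "\<And>l. \<lbrakk>even l; l \<le> k\<rbrakk> \<Longrightarrow> (a + l) mod n \<in> L"
  shows "moves n b a k L (eval w T swap_advance m)"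
  using assms by (simp add: swap_advance_def store_def moves_advance)

text \<open>The round clears the ranks from \<open>b\<close> up to \<open>b'\<close>, the invariant
  those before. The offset restarts at 0, but \<open>rank n b + k < rank n b'\<close> still makes
  the potential grow.\<close>

lemma moves_loop:
  assumes "moves n a b k {t. \<exists>u. beats (letter T) u t} r"
    and "a < n" "b < n" "a \<noteq> b"
    and old: "\<And>t. \<lbrakk>t < n; rank n t < max (rank n a) (rank n b); t \<noteq> a; t \<noteq> b\<rbrakk> \<Longrightarrow> \<exists>u. beats (letter T) u t"
  shows "(\<exists>m. r = Some (m, True) \<and> loop_result n T m) \<or>
    (\<exists>m f. r = Some (m, False) \<and> rank n a + rank n b + k < f \<and> loop_inv n T f m)"
  using assms(1) unfolding moves_def
proof (elim disjE exE conjE)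
  fix m assume "r = Some (m, True)" "m best = a"
    and lost: "\<forall>t<n. rank n b \<le> rank n t \<longrightarrow> t = a \<or> t \<in> {t. \<exists>u. beats (letter T) u t}"
  moreover have "\<exists>u. beats (letter T) u t" if "t < n" "t \<noteq> a" for t
    using that lost old[of t] by (cases "rank n b \<le> rank n t"; cases "t = b") auto
  ultimately show ?thesis
    using \<open>a < n\<close> by (simp add: loop_result_def)
next
  fix m b' assume b': "r = Some (m, False)" "b' < n" "b' \<noteq> a" "rank n b + k < rank n b'"
    and ready: "ready n a b' m"
    and lost: "\<forall>t<n. rank n b \<le> rank n t \<longrightarrow> rank n t < rank n b' \<longrightarrow>
      t = a \<or> t \<in> {t. \<exists>u. beats (letter T) u t}"
  have "\<exists>u. beats (letter T) u t" if "t < n" "rank n t < max (rank n a) (rank n b')" "t \<noteq> a" "t \<noteq> b'" for t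
  proof (cases "rank n b \<le> rank n t \<and> rank n t < rank n b'")
    case False
    \<comment> \<open>Outside the cleared interval, \<open>t\<close> precedes \<open>b\<close> in
      rank or lies between \<open>b'\<close> and \<open>a\<close>.\<close>
    then have "rank n t < max (rank n a) (rank n b)" "t \<noteq> b"
      using that b' by auto
    then show ?thesis using old that by blast
  qed (use lost that in auto)
  then have "loop_inv n T (rank n a + rank n b') m"
    unfolding loop_inv_def using b' ready \<open>a < n\<close>
    by (intro exI[of _ a] exI[of _ b'] exI[of _ 0]) (auto simp: ready_def)
  then show ?thesis
    using b' by (intro disjI2 exI[of _ m] exI[of _ "rank n a + rank n b'"]) simp
qed

lemma loop_body:
  assumes "primitive T" "loop_inv n T f m"
  shows "f < 7 * n \<and> ((\<exists>m'. eval w T body m = Some (m', True) \<and> loop_result n T m') \<or>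
    (\<exists>m' f'. eval w T body m = Some (m', False) \<and> f < f' \<and> loop_inv n T f' m'))"
proof -
  obtain a b k where ab: "a < n" "b < n" "a \<noteq> b" and m: "m best = a" "m rival = b"
    "m best_pos = (a + k) mod n" "m rival_pos = (b + k) mod n" "m parity = k mod 2" "m len = n"
    and agree: "\<And>i. i < k \<Longrightarrow> letter T (a + i) = letter T (b + i)"
    and old: "\<And>t. \<lbrakk>t < n; rank n t < max (rank n a) (rank n b); t \<noteq> a; t \<noteq> b\<rbrakk> \<Longrightarrow> \<exists>u. beats (letter T) u t"
    and f: "f = rank n a + rank n b + k"
    using assms(2) unfolding loop_inv_def by blast
  have "k < n"
    using primitive_letters_differ[OF \<open>primitive T\<close>, of a b] ab agree n
    by (metis linorder_not_less order.strict_trans1)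
  \<comment> \<open>Each rank is below \<open>3 * n\<close> and the offset below
    \<open>n\<close>.\<close>
  have "f < 7 * n"
    using ab \<open>k < n\<close> by (auto simp: f rank_def)
  have lt: "(a + k) mod n < length T" "(b + k) mod n < length T"
    using ab n(1) by (auto intro!: mod_less_divisor)
  have letters: "T ! ((a + k) mod n) = letter T (a + k)" "T ! ((b + k) mod n) = letter T (b + k)"
    using n by (auto simp: letter_def)
  have w: "2 \<le> (2 :: nat) ^ w" using n by simp
  have lost: "(q + l) mod n \<in> {t. \<exists>u. beats (letter T) u t}"
    if "beats_at (letter T) p q k" "even l" "l \<le> k" for p q l
    using beats_shift[OF that] beats_mod[of T "p + l" "q + l"] n by auto
  have adv: "moves n a b k {t. \<exists>u. beats (letter T) u t} (eval w T advance m)"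
    if "beats_at (letter T) a b k"
    using m ab \<open>k < n\<close> lost[OF that] by (intro moves_advance)
  have swp: "moves n b a k {t. \<exists>u. beats (letter T) u t} (eval w T swap_advance m)"
    if "beats_at (letter T) b a k"
    using m ab \<open>k < n\<close> lost[OF that] by (intro moves_swap_advance)
  have step: "?thesis"
    if "beats_at (letter T) a b k \<and> eval w T body m = eval w T advance m \<or>
      beats_at (letter T) b a k \<and> eval w T body m = eval w T swap_advance m"
    using that
  proof (elim disjE conjE)
    assume "beats_at (letter T) a b k" "eval w T body m = eval w T advance m"
    then show ?thesis
      using moves_loop[OF adv] ab old f \<open>f < 7 * n\<close> by simp
  next
    assume "beats_at (letter T) b a k" "eval w T body m = eval w T swap_advance m"
    moreover have "\<And>t. \<lbrakk>t < n; rank n t < max (rank n b) (rank n a); t \<noteq> b; t \<noteq> a\<rbrakk> \<Longrightarrow> \<exists>u. beats (letter T) u t"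
      using old by (simp add: max.commute)
    ultimately show ?thesis
      using moves_loop[OF swp] ab f \<open>f < 7 * n\<close> by (simp add: add.commute)
  qed
  consider "letter T (a + k) = letter T (b + k)" | "letter T (a + k) < letter T (b + k)"
    | "letter T (b + k) < letter T (a + k)"
    by (meson linorder_less_linear)
  then show ?thesis
  proof cases
    case 1
    let ?m = "m(best_pos := (a + Suc k) mod n, rival_pos := (b + Suc k) mod n, parity := Suc k mod 2)"
    have "eval w T body m = Some (?m, False)"
    proof -
      \<comment> \<open>Word subtraction from 1 flips the parity bit.\<close>
      have "(Suc 0 + 2 ^ w - k mod 2) mod 2 ^ w = Suc k mod 2"
        using w by (cases "even k") (auto simp: mod_Suc even_iff_mod_2_eq_zero odd_iff_mod_2_eq_one)
      \<comment> \<open>An increment gives at most \<open>n < 2 ^ w\<close>, so nothing overflows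
        before \<open>Mod\<close>.\<close>
      moreover have "Suc (x mod n) mod 2 ^ w mod n mod 2 ^ w = Suc x mod n" for x
      proof -
        have "x mod n < n" "Suc x mod n < 2 ^ w"
          using n(2,3) by (auto intro: order.strict_trans[OF mod_less_divisor])
        then show ?thesis
          by (simp add: Suc_mod_word mod_Suc_eq)
      qed
      ultimately show ?thesis
        using 1 m lt letters word_size_pos
        by (auto simp: body_def step_pos_def store_def fun_eq_iff)
    qed
    moreover have "loop_inv n T (Suc f) ?m"
      unfolding loop_inv_def using ab m agree old 1
      by (intro exI[of _ a] exI[of _ b] exI[of _ "Suc k"]) (auto simp: f less_Suc_eq)
    ultimately show ?thesis using \<open>f < 7 * n\<close> by auto
  next
    case 2
    show ?thesis
      by (rule step) (use 2 m lt letters agree in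
        \<open>auto simp: body_def beats_at_def even_iff_mod_2_eq_zero\<close>)
  next
    case 3
    show ?thesis
      by (rule step) (use 3 m lt letters agree in
        \<open>auto simp: body_def beats_at_def even_iff_mod_2_eq_zero\<close>)
  qed
qed

lemma eval_start:
  "\<exists>m f. eval w T start (\<lambda>_. 0) = Some (m, False) \<and> loop_inv n T f m"
proof -
  define b where "b = (if n = 2 then 1 else 2 :: nat)"
  define m :: memory where "m = (\<lambda>_. 0)(len := n, rival_pos := b, rival := b)"
  have eval: "eval w T start (\<lambda>_. 0) = Some (m, False)"
    using n word_size_pos
    by (auto simp: start_def store_def eval_bump eval_restart m_def b_def fun_eq_iff)
  have "ready n 0 b m"
    by (simp add: m_def ready_def)
  \<comment> \<open>The enumeration begins with 0 and \<open>b\<close>, so no defeat has to be known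
    yet.\<close>
  moreover have "t = 0 \<or> t = b" if "t < n" "rank n t < max (rank n 0) (rank n b)" for t
    using that n by (auto simp: rank_def b_def split: if_splits)
  moreover have "b < n" "b \<noteq> 0"
    using n(2) by (auto simp: b_def)
  ultimately have "loop_inv n T (rank n 0 + rank n b + 0) m"
    unfolding loop_inv_def
    by (intro exI[of _ 0] exI[of _ b]) (auto simp: ready_def)
  with eval show ?thesis by blast
qed

end

section \<open>The complete run and its cost\<close>

lemma galois_program_one:
  assumes "length T = 1" "length T < 2 ^ w"
  shows "eval w T start (\<lambda>_. 0) = Some ((\<lambda>_. 0)(len := 1), True)"
  using assms by (cases w) (auto simp: start_def store_def)

lemma galois_program_computes:
  assumes "primitive T" "length T < 2 ^ w"
  shows "\<exists>i<length T. computes_within w galois_program T ((depth start + 7 * depth body) * length T) 7 i \<and>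
    galois_rotation T (drop i T @ take i T)"
proof -
  let ?n = "length T" and ?p = galois_program and ?l = "code_size start"
  have "1 \<le> ?n"
    using primitive_nonempty[OF \<open>primitive T\<close>] by (cases T) auto
  have start: "?p = [] @ compile ?l (length ([] :: program)) start @ compile ?l ?l body"
    by (simp add: galois_program_def)
  have body: "?p = compile ?l 0 start @
      compile (length (compile ?l 0 start)) (length (compile ?l 0 start)) body"
    by (simp add: galois_program_def)
  have "\<exists>t\<le>(depth start + 7 * depth body) * ?n. halted ?p (config_after w ?p T t) \<and>
    loop_result ?n T (mem (config_after w ?p T t))"
  proof (cases "?n = 1")
    case True
    obtain t a where "t \<le> depth start"
      "config_after w ?p T t = \<lparr>pc = a, mem = (\<lambda>_. 0)(len := 1)\<rparr>"
      "halted ?p \<lparr>pc = a, mem = (\<lambda>_. 0)(len := 1)\<rparr>"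
      using eval_steps[OF well_formed_start galois_program_one[OF True assms(2)] start]
      unfolding config_after_def by auto
    then show ?thesis
      using True by (intro exI[of _ t]) (auto simp: loop_result_def)
  next
    case False
    with \<open>1 \<le> ?n\<close> have n: "?n = length T" "2 \<le> ?n" "?n < 2 ^ w"
      using assms by auto
    obtain m f where m: "eval w T start (\<lambda>_. 0) = Some (m, False)" "loop_inv ?n T f m"
      using eval_start[OF n] by blast
    obtain t where t: "t \<le> depth start" "config_after w ?p T t = \<lparr>pc = ?l, mem = m\<rparr>"
      using eval_steps[OF well_formed_start m(1) start] unfolding config_after_def by auto
    have "\<exists>t\<le>(7 * ?n - f) * depth body. \<exists>r.
      (step w ?p T ^^ t) \<lparr>pc = length (compile ?l 0 start), mem = m\<rparr> = r \<and>
      halted ?p r \<and> loop_result ?n T (mem r)"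
      using loop_body[OF n \<open>primitive T\<close>] m(2)
      by (intro loop_steps[OF well_formed_body body, where I = "loop_inv ?n T"]) blast+
    then obtain u where u: "u \<le> (7 * ?n - f) * depth body"
      "halted ?p ((step w ?p T ^^ u) \<lparr>pc = ?l, mem = m\<rparr>)"
      "loop_result ?n T (mem ((step w ?p T ^^ u) \<lparr>pc = ?l, mem = m\<rparr>))"
      by auto
    have "config_after w ?p T (u + t) = (step w ?p T ^^ u) \<lparr>pc = ?l, mem = m\<rparr>"
      using t by (simp add: config_after_def funpow_add)
    moreover have "u + t \<le> (depth start + 7 * depth body) * ?n"
    proof -
      have "u \<le> 7 * ?n * depth body"
        using u(1) by (meson diff_le_self le_trans mult_le_mono1)
      moreover have "t \<le> depth start * ?n"
        using t(1) \<open>1 \<le> ?n\<close> by (metis le_trans mult.right_neutral mult_le_mono2)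
      ultimately show ?thesis by (simp add: algebra_simps)
    qed
    ultimately show ?thesis using u by auto
  qed
  then obtain t where t: "t \<le> (depth start + 7 * depth body) * ?n"
    "halted ?p (config_after w ?p T t)" "loop_result ?n T (mem (config_after w ?p T t))"
    by blast
  \<comment> \<open>The run may halt early; the halted configuration persists until the exact time
    claimed.\<close>
  obtain d where d: "(depth start + 7 * depth body) * ?n = d + t"
    using t(1) by (metis add.commute le_Suc_ex)
  have "config_after w ?p T (d + t) = config_after w ?p T t"
    using steps_after_halt[OF t(2)] by (simp add: config_after_def funpow_add)
  then have "computes_within w ?p T ((depth start + 7 * depth body) * ?n) 7
      (mem (config_after w ?p T t) best)"
    unfolding computes_within_def d
    using t(2) card_cells_used[OF instr_cells_galois_program] by simp
  then show ?thesis
    using t(3) galois_rotation_unbeaten[OF \<open>primitive T\<close>] unfolding loop_result_def by blast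
qed

theorem theorem36:
  "\<exists>(p :: program) (ct :: nat) (cs :: nat).
     \<forall>(T :: 'a::linorder list) (w :: nat).
       primitive T \<and> length T < 2 ^ w \<longrightarrow>
         (\<exists>i. i < length T \<and>
              computes_within w p T (ct * length T) cs i \<and>
              galois_rotation T (drop i T @ take i T))"
  using galois_program_computes by blast

end
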